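(* Let $\lambda=\frac{d-1}{2}$ be a positive integer or half-integer (i.e. $d\ge 2$ is an integer). Then for every integer $n\geq 0$ the kernel $K_n^\lambda$ satisfies the following estimates: $$K_n^\lambda(\cos\vartheta)\leq \frac{1}{2^{\lfloor\lambda\rfloor}\left(\sin\frac{\vartheta}{2}\right)^{2\lambda+2}}\sum_{\ell=0}^{\lfloor\lambda\rfloor}\binom{\lfloor\lambda\rfloor}{\ell}\frac{(2\lambda+1)_{\ell+1}}{(n+2\lambda+1)_{\ell+1}}\qquad\text{for } 0<\vartheta\leq\pi,$$ and $$K_n^\lambda(\cos\vartheta)\leq\frac{(n+4\lambda+1)_n}{(n+2\lambda)_n}\qquad\text{for } 0\leq\vartheta\leq\pi,$$ where $(a)_m=a(a-1)\cdots(a-m+1)$ denotes the falling factorial (with $(a)_0=1$).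
   Context: For $\lambda>0$, $C_k^\lambda$ denotes the $k$-th Gegenbauer polynomial of index $\lambda$, given by $\sum_{k=0}^\infty C_k^\lambda(\cos\vartheta)z^k=(1-2z\cos\vartheta+z^2)^{-\lambda}$. Put $A_n^\alpha=\binom{n+\alpha}{n}$, so that $\sum_{n\ge0}A_n^\alpha z^n=(1-z)^{-\alpha-1}$. The (Kogbetliantz) kernel $K_n^\lambda$ is the Cesàro mean of order $2\lambda+1$ of the ultraspherical Dirichlet kernel: $$K_n^\lambda(t)=\frac{1}{A_n^{2\lambda+1}}\sum_{k=0}^n A_{n-k}^{2\lambda+1}\,\frac{k+\lambda}{\lambda}\,C_k^\lambda(t).$$ Here $d$ is the dimension of the sphere $\mathbb{S}^d\subset\mathbb{R}^{d+1}$ and $\lambda=\frac{d-1}{2}$ is the corresponding Gegenbauer parameter; "half-integer" means an element of $\frac12+\mathbb{Z}$, so $\lambda\in\{\frac12,1,\frac32,2,\dots\}$. $\lfloor\cdot\rfloor$ is the floor function. *)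

theory Defs
  imports "HOL-Analysis.Analysis"
begin

definition ffact :: "real \<Rightarrow> nat \<Rightarrow> real" where
  "ffact a m = (\<Prod>i<m. a - real i)"

(* fps_binomial a is the formal series (1 + X)^a, so this composition is the generating
   function (1 - 2 t X + X^2)^(-lam). Composing is legitimate because the inner series
   has zero constant term. *)
definition gegenbauer :: "real \<Rightarrow> nat \<Rightarrow> real \<Rightarrow> real" where
  "gegenbauer lam k t =
     fps_nth (fps_compose (fps_binomial (-lam)) (fps_X ^ 2 - fps_const (2 * t) * fps_X)) k"

definition cesaro_number :: "real \<Rightarrow> nat \<Rightarrow> real" where
  "cesaro_number \<alpha> n = (real n + \<alpha>) gchoose n"

definition kogbetliantz_kernel :: "real \<Rightarrow> nat \<Rightarrow> real \<Rightarrow> real" where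
  "kogbetliantz_kernel lam n t =
     1 / cesaro_number (2 * lam + 1) n *
     (\<Sum>k=0..n. cesaro_number (2 * lam + 1) (n - k) * ((real k + lam) / lam) * gegenbauer lam k t)"

end

theory Submission
  imports Defs
begin

text \<open>
  Write $s = \sin(\vartheta/2)$, $t = \cos\vartheta$ and $R = 1 - 2tX + X^2$. The numbers
  $A_n^{2\lambda+1} K_n^\lambda(t)$ are the coefficients of
  $(1+X)(1-X)^{-2\lambda-1}R^{-\lambda-1}$, so raising $\lambda$ by one multiplies this series by
  $U = (1-X)^{-2}R^{-1}$. From $R = (1-X)^2 + 4s^2X$ and $|C_k^1(t)| \le k+1$ one gets
  $0 \le U_n \le (n+2)/(2s^2)$, the upper bound being the coefficient of
  $s^{-2}(1-X)^{-2}(1-X/2)$; hence the first estimate propagates from $\lambda$ to $\lambda+1$, and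
  expanding $(1-X/2)^m = 2^{-m}(1+(1-X))^m$ gives the stated sum.

  The induction starts at $\lambda = 0$ with the Fej\'er kernel
  $\Phi = (1+X)(1-X)^{-1}R^{-1}$, where $0 \le \Phi_n \le s^{-2}$, and at $\lambda = 1/2$ with
  $\Phi \cdot (1-X)^{-1}R^{-1/2}$. The second factor has as coefficients the partial sums of the
  Legendre series. They are at most $1/s$, because $R^{-1/2}$ at $t = 2q-1$ is the average of
  $(1+X)R^{-1}$ at $2q\cos^2\psi - 1$ over $\psi \in [0,\pi]$ (Mehler's formula made polynomial),
  and the average of $1/(1 - q\cos^2\psi)$ is $1/\sqrt{1-q} = 1/s$.

  The second estimate is $K_n^\lambda(t) \le K_n^\lambda(1)$.
\<close>

unbundle no vec_syntax
unbundle fps_syntax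

subsection \<open>Real powers of formal power series\<close>

text \<open>The power (1 + b)^a with real exponent a. Composition behaves well only for inner series
  without constant term, hence the recurring assumption \<open>b $ 0 = 0\<close>.\<close>

definition one_plus_rpow :: "real fps \<Rightarrow> real \<Rightarrow> real fps" where
  "one_plus_rpow b a = fps_binomial a oo b"

lemma one_plus_rpow_nth_0 [simp]: "one_plus_rpow b a $ 0 = 1"
  by (simp add: one_plus_rpow_def)

lemma one_plus_rpow_0 [simp]: "one_plus_rpow b 0 = 1"
  by (simp add: one_plus_rpow_def)

lemma one_plus_rpow_1 [simp]: "b $ 0 = 0 \<Longrightarrow> one_plus_rpow b 1 = 1 + b"
  by (simp add: one_plus_rpow_def fps_binomial_1 fps_compose_add_distrib)

lemma one_plus_rpow_add:
  "b $ 0 = 0 \<Longrightarrow> one_plus_rpow b (a + c) = one_plus_rpow b a * one_plus_rpow b c"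
  by (simp add: one_plus_rpow_def fps_binomial_add_mult fps_compose_mult_distrib)

lemma one_plus_rpow_Suc:
  assumes "b $ 0 = 0"
  shows "one_plus_rpow b (a + 1) = (1 + b) * one_plus_rpow b a"
  using one_plus_rpow_add[OF assms, of a 1] assms by (simp add: mult.commute)

lemma one_plus_rpow_deriv:
  assumes "b $ 0 = 0"
  shows "fps_deriv (one_plus_rpow b a) = fps_const a * one_plus_rpow b (a - 1) * fps_deriv b"
proof -
  have "fps_binomial a = fps_binomial (a - 1) * (1 + fps_X :: real fps)"
    using fps_binomial_add_mult[of "a - 1" 1] by (simp add: fps_binomial_1)
  then have "fps_deriv (fps_binomial a) = fps_const a * fps_binomial (a - 1)"
    unfolding fps_binomial_deriv
    by (simp add: fps_divide_unit mult.assoc inverse_mult_eq_1')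
  then show ?thesis
    unfolding one_plus_rpow_def
    by (simp add: fps_compose_deriv[OF assms] fps_const_mult_apply_left)
qed

section \<open>The series (1 - X)^(-a) and R^(-a)\<close>

text \<open>This is (1 - X)^(-a). The exponent is negated so that the coefficients, the Cesaro
  numbers of order a - 1, are nonnegative for a \<ge> 0.\<close>

definition neg_rpow :: "real \<Rightarrow> real fps" where
  "neg_rpow a = one_plus_rpow (- fps_X) (- a)"

definition quad :: "real \<Rightarrow> real fps" where
  "quad t = 1 - fps_const (2 * t) * fps_X + fps_X ^ 2"

definition gegenbauer_fps :: "real \<Rightarrow> real \<Rightarrow> real fps" where
  "gegenbauer_fps a t = one_plus_rpow (fps_X ^ 2 - fps_const (2 * t) * fps_X) (- a)"

lemma gegenbauer_fps_nth: "gegenbauer_fps a t $ k = gegenbauer a k t"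
  by (simp add: gegenbauer_fps_def gegenbauer_def one_plus_rpow_def)

lemma neg_rpow_nth: "neg_rpow a $ n = pochhammer a n / fact n"
  by (simp add: neg_rpow_def one_plus_rpow_def fps_compose_uminus' gbinomial_pochhammer)

lemma neg_rpow_nth_nonneg: "a \<ge> 0 \<Longrightarrow> neg_rpow a $ n \<ge> 0"
  by (cases "a = 0") (auto simp: neg_rpow_nth pochhammer_nonneg pochhammer_0_left)

lemma neg_rpow_0 [simp]: "neg_rpow 0 = 1"
  by (simp add: neg_rpow_def)

lemma neg_rpow_add: "neg_rpow (a + b) = neg_rpow a * neg_rpow b"
  using one_plus_rpow_add[of "- fps_X" "-a" "-b"] by (simp add: neg_rpow_def)

lemma neg_rpow_Suc: "(1 - fps_X) * neg_rpow (a + 1) = neg_rpow a"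
  using one_plus_rpow_Suc[of "- fps_X" "- (a + 1)"] by (simp add: neg_rpow_def)

lemma neg_rpow_diff_of_nat: "(1 - fps_X) ^ l * neg_rpow a = neg_rpow (a - real l)"
proof (induction l)
  case (Suc l)
  have "(1 - fps_X) ^ Suc l * neg_rpow a = (1 - fps_X) * neg_rpow (a - real (Suc l) + 1)"
    using Suc by (simp add: mult.assoc)
  then show ?case by (simp only: neg_rpow_Suc)
qed simp

lemma neg_rpow_1_nth [simp]: "neg_rpow 1 $ n = 1"
  by (simp add: neg_rpow_nth flip: pochhammer_fact)

lemma neg_rpow_2_nth: "neg_rpow 2 $ n = real n + 1"
proof -
  have "neg_rpow 2 = neg_rpow 1 * neg_rpow 1" using neg_rpow_add[of 1 1] by simp
  then show ?thesis by (simp add: fps_mult_nth)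
qed

lemma neg_rpow_deriv: "fps_deriv (neg_rpow a) = fps_const a * neg_rpow (a + 1)"
proof -
  have "- a - 1 = - (a + 1)" by simp
  moreover have "fps_const (- a) * fps_const (- 1) = (fps_const a :: real fps)"
    by simp
  moreover have "fps_deriv (- fps_X :: real fps) = fps_const (- 1)" "(- fps_X :: real fps) $ 0 = 0"
    by simp_all
  moreover have "x * y * z = (x * z) * y" for x y z :: "real fps" by (simp only: ac_simps)
  ultimately show ?thesis
    unfolding neg_rpow_def by (simp only: one_plus_rpow_deriv)
qed

lemma gegenbauer_fps_0 [simp]: "gegenbauer_fps 0 t = 1"
  by (simp add: gegenbauer_fps_def)

lemma gegenbauer_fps_nth_0 [simp]: "gegenbauer_fps a t $ 0 = 1"
  by (simp add: gegenbauer_fps_def)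

lemma gegenbauer_fps_add: "gegenbauer_fps (a + b) t = gegenbauer_fps a t * gegenbauer_fps b t"
  using one_plus_rpow_add[of "fps_X ^ 2 - fps_const (2 * t) * fps_X" "-a" "-b"]
  by (simp add: gegenbauer_fps_def)

lemma gegenbauer_fps_Suc: "quad t * gegenbauer_fps (a + 1) t = gegenbauer_fps a t"
proof -
  have "1 + (fps_X ^ 2 - fps_const (2 * t) * fps_X) = quad t"
    by (simp add: quad_def)
  then show ?thesis
    using one_plus_rpow_Suc[of "fps_X ^ 2 - fps_const (2 * t) * fps_X" "- (a + 1)"]
    by (simp add: gegenbauer_fps_def)
qed

lemma gegenbauer_fps_1: "quad t * gegenbauer_fps 1 t = 1"
  using gegenbauer_fps_Suc[of t 0] by simp

lemma gegenbauer_fps_deriv: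
  "fps_deriv (gegenbauer_fps a t) = fps_const (2 * a) * (fps_const t - fps_X) * gegenbauer_fps (a + 1) t"
proof -
  let ?b = "fps_X ^ 2 - fps_const (2 * t) * fps_X :: real fps"
  have b: "fps_deriv ?b = fps_const (- 2) * (fps_const t - fps_X)"
    by (simp add: power2_eq_square algebra_simps numeral_fps_const)
  have "fps_const (- a) * fps_const (- 2) = (fps_const (2 * a) :: real fps)"
    by simp
  moreover have "- a - 1 = - (a + 1)" by simp
  moreover have "?b $ 0 = 0" by simp
  moreover have "x * q * (y * z) = (x * y) * z * q" for x y z q :: "real fps" by (simp only: ac_simps)
  ultimately show ?thesis
    unfolding gegenbauer_fps_def by (simp only: one_plus_rpow_deriv b)
qed

lemma quad_mult_nth:
  "(quad t * f) $ 0 = f $ 0"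
  "(quad t * f) $ Suc 0 = f $ Suc 0 - 2 * t * f $ 0"
  "(quad t * f) $ Suc (Suc n) = f $ Suc (Suc n) - 2 * t * f $ Suc n + f $ n"
proof -
  have "quad t * f = f - fps_const (2 * t) * (fps_X * f) + fps_X * (fps_X * f)"
    by (simp add: quad_def ring_distribs power2_eq_square mult.assoc)
  then show "(quad t * f) $ 0 = f $ 0"
    "(quad t * f) $ Suc 0 = f $ Suc 0 - 2 * t * f $ 0"
    "(quad t * f) $ Suc (Suc n) = f $ Suc (Suc n) - 2 * t * f $ Suc n + f $ n"
    by simp_all
qed

text \<open>Multiplying the cosine series by R leaves 1 - X^2, because cos((k+1)\<theta>) +
  cos((k-1)\<theta>) = 2 cos \<theta> cos(k\<theta>); then R is cancelled.\<close>

lemma poisson_kernel_fps: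
  "(1 - fps_X ^ 2) * gegenbauer_fps 1 (cos \<theta>) = Abs_fps (\<lambda>n. if n = 0 then 1 else 2 * cos (real n * \<theta>))"
    (is "_ = ?T")
proof -
  have "quad (cos \<theta>) * ?T = 1 - fps_X ^ 2"
  proof (rule fps_ext)
    fix n :: nat
    \<comment> \<open>The constant term of \<open>?T\<close> is 1 and not 2, so the cosine
      recurrence applies only from n = 3 on; at n = 2 the defect produces the -1 of 1 - X^2.\<close>
    consider "n = 0" | "n = Suc 0" | "n = Suc (Suc 0)" | m where "n = Suc (Suc (Suc m))"
      by (metis not0_implies_Suc)
    then show "(quad (cos \<theta>) * ?T) $ n = (1 - fps_X ^ 2) $ n"
    proof cases
      case 4
      have "cos (real (Suc (Suc (Suc m))) * \<theta>) + cos (real (Suc m) * \<theta>) = 2 * cos \<theta> * cos (real (Suc (Suc m)) * \<theta>)"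
      proof -
        have "real (Suc (Suc (Suc m))) * \<theta> = real (Suc (Suc m)) * \<theta> + \<theta>" "real (Suc m) * \<theta> = real (Suc (Suc m)) * \<theta> - \<theta>"
          by (simp_all add: algebra_simps)
        then show ?thesis by (simp only: cos_add cos_diff) simp
      qed
      then show ?thesis
        unfolding 4 quad_mult_nth by (simp add: fps_X_power_nth del: of_nat_Suc)
    next
      case 3
      have "cos (2 * \<theta>) = 2 * cos \<theta> * cos \<theta> - 1"
        by (simp add: cos_double_cos power2_eq_square)
      then show ?thesis unfolding 3 quad_mult_nth by (simp add: fps_X_power_nth)
    next
      case 2
      show ?thesis unfolding 2 quad_mult_nth by (simp add: fps_X_power_nth)
    next
      case 1
      show ?thesis unfolding 1 quad_mult_nth by (simp add: fps_X_power_nth)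
    qed
  qed
  moreover have "?T = gegenbauer_fps 1 (cos \<theta>) * (quad (cos \<theta>) * ?T)"
    using gegenbauer_fps_1[of "cos \<theta>"] by (simp add: mult.commute flip: mult.assoc)
  ultimately show ?thesis by (simp only: mult.commute)
qed

section \<open>Coefficientwise inequalities for products and powers\<close>

text \<open>The bound passes through h f \<le> k f \<le> k g, using f \<ge> 0 and then k \<ge> 0.
  The coefficients of h may have either sign, so an upper bound is enough for the starting kernels
  below.\<close>

lemma fps_mult_nth_mono:
  fixes f g h k :: "real fps"
  assumes "\<And>n. 0 \<le> f $ n" "\<And>n. f $ n \<le> g $ n" "\<And>n. h $ n \<le> k $ n" "\<And>n. 0 \<le> k $ n"
  shows "(h * f) $ n \<le> (k * g) $ n"
proof -
  have "h $ i * f $ j \<le> k $ i * g $ j" for i j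
    using mult_right_mono[OF assms(3)[of i] assms(1)[of j]]
          mult_left_mono[OF assms(2)[of j] assms(4)[of i]] by linarith
  then show ?thesis by (simp add: fps_mult_nth sum_mono)
qed

lemma fps_mult_nth_nonneg:
  fixes f g :: "real fps"
  assumes "\<And>n. 0 \<le> f $ n" "\<And>n. 0 \<le> g $ n"
  shows "0 \<le> (f * g) $ n"
  using assms by (simp add: fps_mult_nth sum_nonneg)

lemma fps_power_nth_nonneg:
  fixes f :: "real fps"
  assumes "\<And>n. 0 \<le> f $ n"
  shows "0 \<le> (f ^ m) $ n"
  by (induction m arbitrary: n) (simp_all add: assms fps_mult_nth_nonneg)

lemma fps_power_nth_mono:
  fixes f g :: "real fps"
  assumes "\<And>n. 0 \<le> f $ n" "\<And>n. f $ n \<le> g $ n"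
  shows "(f ^ m) $ n \<le> (g ^ m) $ n"
proof (induction m arbitrary: n)
  case (Suc m)
  show ?case
    unfolding power_Suc
    by (rule fps_mult_nth_mono) (use assms Suc fps_power_nth_nonneg order_trans in blast)+
qed simp

subsection \<open>Gegenbauer coefficients and the Fejer kernel\<close>

text \<open>Logarithmic derivative: X f' = 2a X (1 - X)^(-1) f for f = (1 - X)^(-2a). This is the
  recurrence of \<open>gegenbauer_fps_rec\<close> with every cosine replaced by 1.\<close>

lemma neg_rpow_rec:
  "real k * neg_rpow (2 * a) $ k = a * (\<Sum>j=1..k. 2 * neg_rpow (2 * a) $ (k - j))"
proof -
  have "fps_X * fps_deriv (neg_rpow (2 * a)) = fps_const (2 * a) * (fps_X * neg_rpow 1 * neg_rpow (2 * a))"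
    by (simp add: neg_rpow_deriv neg_rpow_add ac_simps)
  from arg_cong[OF this, of "\<lambda>f. f $ k"]
  have "real k * neg_rpow (2 * a) $ k = 2 * a * (fps_X * neg_rpow 1 * neg_rpow (2 * a)) $ k"
    by (cases k) (simp_all add: mult.assoc)
  also have "(fps_X * neg_rpow 1 * neg_rpow (2 * a)) $ k = (\<Sum>j=1..k. neg_rpow (2 * a) $ (k - j))"
    by (subst fps_mult_nth, subst sum.atLeast_Suc_atMost) (auto intro!: sum.cong)
  finally show ?thesis by (simp add: sum_distrib_left mult.assoc mult.left_commute)
qed

text \<open>The logarithmic derivative of R^(-a) is 2a (t - X) / R. Since 2X (t - X) = (1 - X^2) -
  R, X times it is a times the cosine series without its constant term.\<close>

lemma gegenbauer_fps_rec:
  "real k * gegenbauer_fps a (cos \<theta>) $ k =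
     a * (\<Sum>j=1..k. 2 * cos (real j * \<theta>) * gegenbauer_fps a (cos \<theta>) $ (k - j))"
proof -
  let ?G = "\<lambda>a. gegenbauer_fps a (cos \<theta>)"
  let ?T = "Abs_fps (\<lambda>n. if n = 0 then 1 else 2 * cos (real n * \<theta>))"
  have "fps_const 2 * (fps_X * (fps_const (cos \<theta>) - fps_X)) = (1 - fps_X ^ 2) - quad (cos \<theta>)"
    by (simp add: quad_def algebra_simps power2_eq_square numeral_fps_const)
  then have "fps_const 2 * (fps_X * (fps_const (cos \<theta>) - fps_X)) * ?G 1 = ?T - 1"
    by (simp only: left_diff_distrib[of "1 - fps_X ^ 2"] poisson_kernel_fps gegenbauer_fps_1)
  moreover have "fps_X * fps_deriv (?G a) =
      fps_const a * ((fps_const 2 * (fps_X * (fps_const (cos \<theta>) - fps_X)) * ?G 1) * ?G a)"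
  proof -
    have "fps_const (2 * a) = fps_const a * fps_const 2" by simp
    then show ?thesis
      by (simp only: gegenbauer_fps_deriv gegenbauer_fps_add ac_simps)
  qed
  ultimately have "fps_X * fps_deriv (?G a) = fps_const a * ((?T - 1) * ?G a)" by simp
  from arg_cong[OF this, of "\<lambda>f. f $ k"]
  have "real k * ?G a $ k = a * ((?T - 1) * ?G a) $ k"
    by (cases k) simp_all
  also have "((?T - 1) * ?G a) $ k = (\<Sum>j=1..k. 2 * cos (real j * \<theta>) * ?G a $ (k - j))"
    by (subst fps_mult_nth, subst sum.atLeast_Suc_atMost) (auto intro!: sum.cong)
  finally show ?thesis .
qed

text \<open>The two recurrences are compared term by term with |cos| \<le> 1; the bound is the value
  at t = 1.\<close>

lemma abs_gegenbauer_le: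
  assumes "a \<ge> 0"
  shows "\<bar>gegenbauer_fps a (cos \<theta>) $ k\<bar> \<le> neg_rpow (2 * a) $ k"
proof (induction k rule: less_induct)
  case (less k)
  show ?case
  proof (cases "k = 0")
    case False
    have "real k * \<bar>gegenbauer_fps a (cos \<theta>) $ k\<bar> =
        a * \<bar>\<Sum>j=1..k. 2 * cos (real j * \<theta>) * gegenbauer_fps a (cos \<theta>) $ (k - j)\<bar>"
      using arg_cong[OF gegenbauer_fps_rec[of k a \<theta>], of abs] assms by (simp add: abs_mult)
    also have "\<dots> \<le> a * (\<Sum>j=1..k. 2 * neg_rpow (2 * a) $ (k - j))"
    proof (intro mult_left_mono assms order_trans[OF sum_abs] sum_mono)
      fix j assume "j \<in> {1..k}"
      then have "\<bar>cos (real j * \<theta>)\<bar> * \<bar>gegenbauer_fps a (cos \<theta>) $ (k - j)\<bar> \<le> 1 * neg_rpow (2 * a) $ (k - j)"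
        by (intro mult_mono less) auto
      then show "\<bar>2 * cos (real j * \<theta>) * gegenbauer_fps a (cos \<theta>) $ (k - j)\<bar> \<le> 2 * neg_rpow (2 * a) $ (k - j)"
        by (simp add: abs_mult)
    qed
    also have "\<dots> = real k * neg_rpow (2 * a) $ k"
      by (simp only: neg_rpow_rec)
    finally show ?thesis using False by simp
  qed (simp add: neg_rpow_nth)
qed

text \<open>This is R = (1 - X)^2 + 4 s^2 X. Dividing it by R and by powers of 1 - X turns a product
  kernel into a difference of two known series.\<close>

lemma quad_minus_square: "quad t - (1 - fps_X) ^ 2 = fps_const (2 * (1 - t)) * fps_X"
  by (simp add: quad_def power2_eq_square algebra_simps numeral_fps_const)

text \<open>Division of \<open>quad_minus_square\<close> by (1 - X)^2 R gives 2(1 - t) X U = (1 -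
  X)^(-2) - R^(-1). The factor X moves the comparison to the coefficient n + 1.\<close>

lemma neg_rpow_2_mult_gegenbauer_nth:
  "2 * (1 - t) * (neg_rpow 2 * gegenbauer_fps 1 t) $ n = real n + 2 - gegenbauer_fps 1 t $ Suc n"
proof -
  have N: "(1 - fps_X) ^ 2 * neg_rpow 2 = 1"
    using neg_rpow_diff_of_nat[of 2 2] by simp
  have "fps_const (2 * (1 - t)) * fps_X * (neg_rpow 2 * gegenbauer_fps 1 t)
      = (quad t * gegenbauer_fps 1 t) * neg_rpow 2 - ((1 - fps_X) ^ 2 * neg_rpow 2) * gegenbauer_fps 1 t"
    unfolding quad_minus_square[symmetric] by (simp only: ring_distribs ac_simps)
  also have "\<dots> = neg_rpow 2 - gegenbauer_fps 1 t"
    by (simp add: N gegenbauer_fps_1)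
  finally show ?thesis
    by (auto simp: fps_eq_iff mult.assoc neg_rpow_2_nth dest!: spec[of _ "Suc n"])
qed

text \<open>Multiplying \<open>quad_minus_square\<close> by (1 + X)(1 - X)^(-1) R^(-1) leaves (1 +
  X)/(1 - X) minus the cosine series.\<close>

lemma fejer_kernel_nth:
  "2 * (1 - cos \<theta>) * ((1 + fps_X) * neg_rpow 1 * gegenbauer_fps 1 (cos \<theta>)) $ n
     = 2 - 2 * cos (real (Suc n) * \<theta>)"
proof -
  let ?G = "gegenbauer_fps 1 (cos \<theta>)"
  have N: "(1 - fps_X) ^ 2 * neg_rpow 1 = 1 - fps_X"
    using neg_rpow_Suc[of 0] by (simp add: power2_eq_square mult.assoc)
  have "fps_const (2 * (1 - cos \<theta>)) * fps_X * ((1 + fps_X) * neg_rpow 1 * ?G)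
      = (1 + fps_X) * neg_rpow 1 * (quad (cos \<theta>) * ?G) - (1 + fps_X) * ((1 - fps_X) ^ 2 * neg_rpow 1) * ?G"
    unfolding quad_minus_square[symmetric] by (simp only: left_diff_distrib right_diff_distrib ac_simps)
  also have "\<dots> = (1 + fps_X) * neg_rpow 1 - (1 - fps_X ^ 2) * ?G"
    unfolding N gegenbauer_fps_1 by (simp add: algebra_simps power2_eq_square)
  finally have "fps_const (2 * (1 - cos \<theta>)) * fps_X * ((1 + fps_X) * neg_rpow 1 * ?G)
      = (1 + fps_X) * neg_rpow 1 - Abs_fps (\<lambda>n. if n = 0 then 1 else 2 * cos (real n * \<theta>))"
    by (simp only: poisson_kernel_fps)
  from arg_cong[OF this, of "\<lambda>f. f $ Suc n"]
  show ?thesis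
    by (simp add: mult.assoc distrib_right del: of_nat_Suc)
qed

lemma fejer_kernel_nonneg:
  assumes "cos \<theta> < 1"
  shows "0 \<le> ((1 + fps_X) * neg_rpow 1 * gegenbauer_fps 1 (cos \<theta>)) $ n" (is "0 \<le> ?F")
proof -
  have "0 \<le> 2 * (1 - cos \<theta>) * ?F" by (simp only: fejer_kernel_nth) simp
  then show ?thesis using assms by (simp add: zero_le_mult_iff)
qed

text \<open>Formulated in x rather than in an angle, because the Legendre average evaluates the
  kernel at x = 2q cos^2 \<psi> - 1.\<close>

lemma fejer_kernel_le:
  assumes "-1 \<le> x" "x < 1"
  shows "((1 + fps_X) * neg_rpow 1 * gegenbauer_fps 1 x) $ n \<le> 2 / (1 - x)" (is "?F \<le> _")
proof -
  have "2 * (1 - cos (arccos x)) * ((1 + fps_X) * neg_rpow 1 * gegenbauer_fps 1 (cos (arccos x))) $ n \<le> 4"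
    by (simp only: fejer_kernel_nth) (use cos_ge_minus_one[of "real (Suc n) * arccos x"] in linarith)
  then have "(1 - x) * ?F \<le> 2"
    using assms by (simp only: cos_arccos mult.assoc mult_le_cancel_left)
  then show ?thesis using assms by (simp add: pos_le_divide_eq mult.commute)
qed

subsection \<open>Partial sums of the Legendre series\<close>

text \<open>Wallis integrals, by induction on j; they are \<pi> times the coefficients of (1 -
  X)^(-1/2).\<close>

lemma has_integral_cos_power_even:
  "((\<lambda>\<psi>. cos \<psi> ^ (2 * j)) has_integral (pi * neg_rpow (1/2) $ j)) {0..pi}"
proof (induction j)
  case 0
  have "((\<lambda>\<psi>. 1 :: real) has_integral (1 * (pi - 0))) {0..pi}"
    using has_integral_const_real[of "1::real" 0 pi] by simp
  then show ?case by (simp add: neg_rpow_nth)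
next
  case (Suc j)
  let ?d = "\<lambda>\<psi>::real. (2 * real j + 2) * cos \<psi> ^ (2 * Suc j) - (2 * real j + 1) * cos \<psi> ^ (2 * j)"
  \<comment> \<open>The antiderivative cos^(2j+1) sin vanishes at both endpoints, so integrating its
    derivative relates the integrals for j and j + 1.\<close>
  have "(?d has_integral (cos pi ^ (2 * j + 1) * sin pi - cos 0 ^ (2 * j + 1) * sin 0)) {0..pi}"
  proof (rule fundamental_theorem_of_calculus)
    fix \<psi> :: real
    have "sin \<psi> * sin \<psi> = 1 - cos \<psi> * cos \<psi>"
      using sin_cos_squared_add[of \<psi>] unfolding power2_eq_square by linarith
    then have "- (real (2 * j + 1) * cos \<psi> ^ (2 * j) * sin \<psi> * sin \<psi>) + cos \<psi> * cos \<psi> ^ (2 * j + 1) = ?d \<psi>"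
      by (simp only: mult.assoc) (simp add: algebra_simps)
    moreover have "((\<lambda>\<psi>. cos \<psi> ^ (2 * j + 1) * sin \<psi>) has_real_derivative
        - (real (2 * j + 1) * cos \<psi> ^ (2 * j) * sin \<psi> * sin \<psi>) + cos \<psi> * cos \<psi> ^ (2 * j + 1))
        (at \<psi> within {0..pi})"
      using DERIV_subset[OF DERIV_mult[OF DERIV_power[OF DERIV_cos, of "2 * j + 1" \<psi>] DERIV_sin] subset_UNIV]
      by (simp add: mult_ac del: power_Suc)
    ultimately show "((\<lambda>\<psi>. cos \<psi> ^ (2 * j + 1) * sin \<psi>) has_vector_derivative ?d \<psi>) (at \<psi> within {0..pi})"
      by (simp only: has_real_derivative_iff_has_vector_derivative)
  qed simp
  from has_integral_mult_right[OF has_integral_add[OF this has_integral_mult_right[OF Suc, of "2 * real j + 1"]],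
      of "1 / (2 * real j + 2)"]
  have "((\<lambda>\<psi>. cos \<psi> ^ (2 * Suc j)) has_integral
      (1 / (2 * real j + 2) * ((2 * real j + 1) * (pi * neg_rpow (1/2) $ j)))) {0..pi}"
    by (simp add: add_pos_nonneg[THEN less_imp_neq[THEN not_sym]] del: power_Suc mult_Suc_right)
  moreover have "neg_rpow (1/2) $ Suc j = (2 * real j + 1) / (2 * real j + 2) * neg_rpow (1/2) $ j"
    by (simp add: neg_rpow_nth pochhammer_Suc field_simps)
  ultimately show ?case by (simp add: mult.left_commute)
qed

text \<open>Averaging 1/(1 - w cos^2 \<psi>) gives (1 - w)^(-1/2). Each coefficient is a finite
  combination of even powers of the cosine, so only Wallis integrals occur.\<close>

lemma has_integral_compose_geometric:
  "((\<lambda>\<psi>. (v * (Abs_fps (\<lambda>j. (cos \<psi> ^ 2) ^ j) oo w)) $ n) has_integral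
      pi * (v * (neg_rpow (1/2) oo w)) $ n) {0..pi}"
proof -
  have "pi * (v * (neg_rpow (1/2) oo w)) $ n =
      (\<Sum>i=0..n. v $ i * (\<Sum>j=0..n - i. (pi * neg_rpow (1/2) $ j) * (w ^ j) $ (n - i)))"
    by (simp add: fps_mult_nth fps_compose_nth sum_distrib_left mult_ac)
  moreover have "((\<lambda>\<psi>. \<Sum>i=0..n. v $ i * (\<Sum>j=0..n - i. cos \<psi> ^ (2 * j) * (w ^ j) $ (n - i))) has_integral
      (\<Sum>i=0..n. v $ i * (\<Sum>j=0..n - i. (pi * neg_rpow (1/2) $ j) * (w ^ j) $ (n - i)))) {0..pi}"
    by (intro has_integral_sum has_integral_mult_right has_integral_mult_left
        has_integral_cos_power_even finite_atLeastAtMost)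
  ultimately show ?thesis
    by (simp add: fps_mult_nth fps_compose_nth flip: power_mult)
qed

text \<open>Since R at t = 2qx - 1 equals (1 + X)^2 (1 - x w), both series become functions of the
  same w. With y = cos^2 \<psi> they are the two sides of
  \<open>has_integral_compose_geometric\<close>, which yields the polynomial form of Mehler's
  formula.\<close>

lemma
  fixes q y :: real
  defines "u \<equiv> inverse (1 + fps_X) :: real fps"
  defines "w \<equiv> fps_const (4 * q) * fps_X * u ^ 2"
  shows gegenbauer_fps_1_compose:
      "(1 + fps_X) * gegenbauer_fps 1 (2 * q * y - 1) = u * (Abs_fps (\<lambda>j. y ^ j) oo w)" (is ?A)
    and gegenbauer_fps_half_compose:
      "gegenbauer_fps (1/2) (2 * q - 1) = u * (neg_rpow (1/2) oo w)" (is ?B)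
proof -
  have u: "u * (1 + fps_X) = 1"
    unfolding u_def by (rule inverse_mult_eq_1) simp
  have w0: "w $ 0 = 0" by (simp add: w_def)
  have nz: "quad t \<noteq> 0" for t
    using gegenbauer_fps_1[of t] by auto
  have uu: "u ^ 2 * (1 + fps_X) ^ 2 = 1"
    by (simp add: u flip: power_mult_distrib)
  have quad: "quad (2 * q * x - 1) = (1 + fps_X) ^ 2 * (1 - fps_const x * w)" for x
  proof -
    have "(1 + fps_X) ^ 2 * (1 - fps_const x * w) =
        (1 + fps_X) ^ 2 - fps_const x * fps_const (4 * q) * fps_X * (u ^ 2 * (1 + fps_X) ^ 2)"
      by (simp only: w_def right_diff_distrib ac_simps mult_1)
    also have "\<dots> = quad (2 * q * x - 1)"
      unfolding uu quad_def
      by (simp add: power2_eq_square algebra_simps numeral_fps_const)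
    finally show ?thesis ..
  qed
  show ?A
  proof -
    let ?g = "Abs_fps (\<lambda>j. y ^ j)"
    have "(1 - fps_const y * fps_X) * ?g = 1"
    proof (rule fps_ext)
      show "((1 - fps_const y * fps_X) * ?g) $ n = 1 $ n" for n
        by (cases n) (simp_all add: left_diff_distrib mult.assoc)
    qed
    then have "((1 - fps_const y * fps_X) oo w) * (?g oo w) = 1"
      using fps_compose_mult_distrib[OF w0, of "1 - fps_const y * fps_X" ?g] by simp
    then have "(1 - fps_const y * w) * (?g oo w) = 1"
      using w0 by (simp add: fps_compose_sub_distrib fps_compose_mult_distrib)
    then have "quad (2 * q * y - 1) * (u * (?g oo w)) = 1 + fps_X"
      unfolding quad by (metis (no_types, opaque_lifting) u mult.assoc mult.commute mult_1 power2_eq_square)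
    also have "\<dots> = quad (2 * q * y - 1) * ((1 + fps_X) * gegenbauer_fps 1 (2 * q * y - 1))"
      using gegenbauer_fps_1[of "2 * q * y - 1"] by (metis mult.left_commute mult_1_right)
    finally show ?thesis using nz by simp
  qed
  show ?B
  proof -
    let ?h = "neg_rpow (1/2)" and ?G = "gegenbauer_fps (1/2) (2 * q - 1)"
    have "(1 - fps_X) * (?h * ?h) = 1"
      using neg_rpow_add[of "1/2" "1/2"] neg_rpow_Suc[of 0] by simp
    then have "((1 - fps_X) oo w) * ((?h oo w) * (?h oo w)) = 1"
      using fps_compose_mult_distrib[OF w0, of "1 - fps_X" "?h * ?h"]
        fps_compose_mult_distrib[OF w0, of ?h ?h] by simp
    then have "(1 - w) * (?h oo w) ^ 2 = 1"
      using w0 by (simp add: fps_compose_sub_distrib power2_eq_square)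
    moreover have "quad (2 * q - 1) = (1 + fps_X) ^ 2 * (1 - w)"
      using quad[of 1] by simp
    then have "quad (2 * q - 1) * (u * (?h oo w)) ^ 2 = (u ^ 2 * (1 + fps_X) ^ 2) * ((1 - w) * (?h oo w) ^ 2)"
      by (simp only: power_mult_distrib ac_simps)
    ultimately have "quad (2 * q - 1) * (u * (?h oo w)) ^ 2 = 1"
      by (simp only: uu mult_1)
    also have "\<dots> = quad (2 * q - 1) * ?G ^ 2"
      using gegenbauer_fps_add[of "1/2" "1/2" "2 * q - 1"] gegenbauer_fps_1[of "2 * q - 1"]
      by (simp add: power2_eq_square)
    finally have "(u * (?h oo w)) ^ 2 = ?G ^ 2" using nz by simp
    \<comment> \<open>Equality of squares leaves a sign open; both constant coefficients are 1,
      which excludes the minus sign.\<close>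
    then have "u * (?h oo w) = ?G \<or> u * (?h oo w) = - ?G"
      by (simp add: power2_eq_iff)
    moreover have "(u * (?h oo w)) $ 0 = 1" by (simp add: u_def neg_rpow_nth)
    then have "u * (?h oo w) \<noteq> - ?G" by (auto simp del: fps_mult_nth_0)
    ultimately show ?thesis by simp
  qed
qed

text \<open>The binomial series of (1 - q)^(-1/2) has nonnegative terms, so its sum dominates its
  partial sums.\<close>

lemma sum_neg_rpow_half_le:
  assumes "0 \<le> q" "q < 1"
  shows "(\<Sum>j<N. neg_rpow (1/2) $ j * q ^ j) \<le> 1 / sqrt (1 - q)"
proof -
  have "(\<lambda>j. (- (1/2) gchoose j) * (- q) ^ j) sums (1 + - q) powr - (1/2)"
    by (rule gen_binomial_real) (use assms in auto)
  moreover have "(- (1/2) gchoose j) * (- q) ^ j = neg_rpow (1/2) $ j * q ^ j" for j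
    by (simp add: gbinomial_pochhammer neg_rpow_nth power_minus[of q] mult_ac)
  ultimately have sums: "(\<lambda>j. neg_rpow (1/2) $ j * q ^ j) sums (1 / sqrt (1 - q))"
    using assms by (simp add: powr_minus powr_half_sqrt field_simps)
  have "(\<Sum>j<N. neg_rpow (1/2) $ j * q ^ j) \<le> (\<Sum>j. neg_rpow (1/2) $ j * q ^ j)"
    using sums assms by (intro sum_le_suminf) (auto simp: sums_iff neg_rpow_nth_nonneg)
  then show ?thesis using sums by (simp add: sums_iff)
qed

text \<open>The geometric series is cut off with an error uniform in y, so that only a trigonometric
  polynomial has to be integrated.\<close>

lemma geometric_partial_sum_le:
  fixes q y :: real
  assumes "0 \<le> q" "q < 1" "0 \<le> y" "y \<le> 1"
  shows "1 / (1 - q * y) \<le> (\<Sum>j<N. q ^ j * y ^ j) + q ^ N / (1 - q)"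
proof -
  have qy: "q * y \<le> q" using assms mult_left_le by blast
  then have pos: "1 - q * y > 0" using assms by linarith
  have "1 / (1 - q * y) = (\<Sum>j<N. (q * y) ^ j) + (q * y) ^ N / (1 - q * y)"
    using pos sum_gp_strict[of "q * y" N] by (simp add: field_simps)
  also have "(q * y) ^ N / (1 - q * y) \<le> q ^ N / (1 - q)"
    using assms qy by (intro frac_le power_mono) auto
  finally show ?thesis by (simp add: power_mult_distrib)
qed

lemma sum_legendre_le:
  assumes "0 \<le> q" "q < 1"
  shows "(neg_rpow 1 * gegenbauer_fps (1/2) (2 * q - 1)) $ n \<le> 1 / sqrt (1 - q)"
proof -
  define S where "S = (neg_rpow 1 * gegenbauer_fps (1/2) (2 * q - 1)) $ n"
  let ?F = "\<lambda>\<psi>. ((1 + fps_X) * neg_rpow 1 * gegenbauer_fps 1 (2 * q * cos \<psi> ^ 2 - 1)) $ n"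
  \<comment> \<open>Mehler's formula after multiplication by (1 - X)^(-1): a Legendre partial sum is
    an average of Fejer kernels.\<close>
  have F: "(?F has_integral (pi * S)) {0..pi}"
  proof -
    let ?u = "inverse (1 + fps_X) :: real fps"
    have "?F \<psi> = (neg_rpow 1 * ?u * (Abs_fps (\<lambda>j. (cos \<psi> ^ 2) ^ j) oo fps_const (4 * q) * fps_X * ?u ^ 2)) $ n" for \<psi>
      using gegenbauer_fps_1_compose[of q "cos \<psi> ^ 2"] by (simp only: ac_simps)
    then show ?thesis
      unfolding S_def gegenbauer_fps_half_compose
      by (simp only: has_integral_compose_geometric flip: mult.assoc[of "neg_rpow 1"])
  qed
  \<comment> \<open>The Fejer kernel at 2q cos^2 \<psi> - 1 is at most 1/(1 - q cos^2 \<psi>). The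
    cut-off N is arbitrary, and the error vanishes as N grows.\<close>
  have bound: "S \<le> 1 / sqrt (1 - q) + q ^ N / (1 - q)" for N
  proof -
    let ?R = "\<lambda>\<psi>. (\<Sum>j<N. q ^ j * cos \<psi> ^ (2 * j)) + q ^ N / (1 - q)"
    have "((\<lambda>\<psi>. q ^ N / (1 - q)) has_integral (pi * (q ^ N / (1 - q)))) {0..pi}"
      using has_integral_const_real[of "q ^ N / (1 - q)" 0 pi] by simp
    then have R: "(?R has_integral ((\<Sum>j<N. q ^ j * (pi * neg_rpow (1/2) $ j)) + pi * (q ^ N / (1 - q)))) {0..pi}"
      by (intro has_integral_add has_integral_sum has_integral_mult_right
          has_integral_cos_power_even finite_lessThan)
    have "?F \<psi> \<le> ?R \<psi>" for \<psi>
    proof -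
      have c: "cos \<psi> ^ 2 \<le> 1" by (simp add: abs_square_le_1)
      then have "q * cos \<psi> ^ 2 \<le> q" using assms mult_left_le by blast
      then have "?F \<psi> \<le> 2 / (1 - (2 * q * cos \<psi> ^ 2 - 1))"
        using assms by (intro fejer_kernel_le) auto
      also have "\<dots> = 2 / (2 * (1 - q * cos \<psi> ^ 2))"
        by (simp add: algebra_simps)
      also have "\<dots> = 1 / (1 - q * cos \<psi> ^ 2)"
        using mult_divide_mult_cancel_left[of 2 1 "1 - q * cos \<psi> ^ 2"] by (simp only: mult_1_right)
      also have "\<dots> \<le> ?R \<psi>"
        using geometric_partial_sum_le[of q "cos \<psi> ^ 2" N] assms c by (simp add: power_mult)
      finally show ?thesis .
    qed
    then have "pi * S \<le> (\<Sum>j<N. q ^ j * (pi * neg_rpow (1/2) $ j)) + pi * (q ^ N / (1 - q))"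
      using has_integral_le[OF F R] by blast
    also have "\<dots> = pi * ((\<Sum>j<N. neg_rpow (1/2) $ j * q ^ j) + q ^ N / (1 - q))"
      by (simp add: sum_distrib_left distrib_left mult_ac)
    finally have "S \<le> (\<Sum>j<N. neg_rpow (1/2) $ j * q ^ j) + q ^ N / (1 - q)"
      by (simp only: mult_le_cancel_left_pos[OF pi_gt_zero])
    then show ?thesis using sum_neg_rpow_half_le[OF assms, of N] by linarith
  qed
  have "(\<lambda>N. 1 / sqrt (1 - q) + q ^ N / (1 - q)) \<longlonglongrightarrow> 1 / sqrt (1 - q) + 0 / (1 - q)"
    using assms by (intro tendsto_intros LIMSEQ_realpow_zero) auto
  then have "S \<le> 1 / sqrt (1 - q) + 0 / (1 - q)"
    by (rule LIMSEQ_le_const) (use bound in blast)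
  then show ?thesis by (simp add: S_def)
qed

subsection \<open>The Kogbetliantz kernel\<close>

lemma cesaro_number_eq: "cesaro_number \<alpha> n = neg_rpow (\<alpha> + 1) $ n"
  by (simp add: cesaro_number_def neg_rpow_nth gbinomial_pochhammer')

lemma cesaro_number_pos: "\<alpha> > -1 \<Longrightarrow> cesaro_number \<alpha> n > 0"
  by (simp add: cesaro_number_eq neg_rpow_nth pochhammer_pos)

text \<open>The weight (k + \<lambda>)/\<lambda> is the action of (X d/dX + \<lambda>)/\<lambda>,
  which maps R^(-\<lambda>) to (1 - X^2) R^(-\<lambda>-1). The Cesaro weights contribute (1 -
  X)^(-2\<lambda>-2), one power of which cancels against 1 - X.\<close>

lemma kogbetliantz_kernel_eq_fps:
  assumes "lam > 0"
  shows "cesaro_number (2 * lam + 1) n * kogbetliantz_kernel lam n t =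
    ((1 + fps_X) * neg_rpow (2 * lam + 1) * gegenbauer_fps (lam + 1) t) $ n"
proof -
  let ?G = "gegenbauer_fps lam t" and ?G' = "gegenbauer_fps (lam + 1) t"
  let ?D = "Abs_fps (\<lambda>k. (real k + lam) / lam * gegenbauer lam k t)"
  have const: "fps_const (2 * lam) = (fps_const lam * fps_const 2 :: real fps)" by simp
  have "fps_const lam * ?D = fps_X * fps_deriv ?G + fps_const lam * ?G"
  proof (rule fps_ext)
    show "(fps_const lam * ?D) $ k = (fps_X * fps_deriv ?G + fps_const lam * ?G) $ k" for k
      using assms by (cases k) (simp_all add: gegenbauer_fps_nth[symmetric] field_simps)
  qed
  also have "\<dots> = fps_const lam * ((fps_const 2 * (fps_X * (fps_const t - fps_X)) + quad t) * ?G')"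
  proof -
    have "fps_X * fps_deriv ?G = fps_const lam * (fps_const 2 * (fps_X * (fps_const t - fps_X)) * ?G')"
      unfolding gegenbauer_fps_deriv const by (simp only: ac_simps)
    moreover have "fps_const lam * ?G = fps_const lam * (quad t * ?G')"
      by (simp only: gegenbauer_fps_Suc)
    ultimately show ?thesis by (simp only: distrib_left distrib_right)
  qed
  also have "fps_const 2 * (fps_X * (fps_const t - fps_X)) + quad t = 1 - fps_X ^ 2"
    by (simp add: quad_def algebra_simps power2_eq_square numeral_fps_const)
  finally have D: "?D = (1 - fps_X ^ 2) * ?G'"
    using assms by simp
  have N: "(1 - fps_X) * neg_rpow (2 * lam + 2) = neg_rpow (2 * lam + 1)"
    using neg_rpow_Suc[of "2 * lam + 1"] by (simp add: add.assoc)
  have "cesaro_number (2 * lam + 1) n * kogbetliantz_kernel lam n t = (?D * neg_rpow (2 * lam + 2)) $ n"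
    using cesaro_number_pos[of "2 * lam + 1" n] assms
    unfolding kogbetliantz_kernel_def fps_mult_nth
    by (simp add: cesaro_number_eq mult_ac add.assoc)
  also have "?D * neg_rpow (2 * lam + 2) = (1 + fps_X) * ((1 - fps_X) * neg_rpow (2 * lam + 2)) * ?G'"
    unfolding D by (simp add: algebra_simps power2_eq_square)
  finally show ?thesis by (simp only: N)
qed

section \<open>Raising the dimension by powers of U\<close>

lemma neg_rpow_power: "neg_rpow a ^ m = neg_rpow (a * real m)"
proof (induction m)
  case (Suc m)
  have "a * real (Suc m) = a + a * real m" by (simp add: algebra_simps)
  with Suc show ?case by (simp add: neg_rpow_add)
qed simp

lemma gegenbauer_fps_power: "gegenbauer_fps a t ^ m = gegenbauer_fps (a * real m) t"
proof (induction m)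
  case (Suc m)
  have "a * real (Suc m) = a + a * real m" by (simp add: algebra_simps)
  with Suc show ?case by (simp add: gegenbauer_fps_add)
qed simp

text \<open>Both bounds come from 4 s^2 U_n = n + 2 - C^1_(n+1) and |C^1_(n+1)| \<le> n + 2. The
  upper one is kept as a series coefficient so that powers of U are dominated by powers of a
  series.\<close>

lemma dimension_step_nth:
  fixes \<theta> s :: real
  assumes "s > 0" "1 - cos \<theta> = 2 * s ^ 2"
  shows "0 \<le> (neg_rpow 2 * gegenbauer_fps 1 (cos \<theta>)) $ n" (is "0 \<le> ?U")
    and "(neg_rpow 2 * gegenbauer_fps 1 (cos \<theta>)) $ n
        \<le> (fps_const (1 / s ^ 2) * (neg_rpow 2 * (1 - fps_const (1/2) * fps_X))) $ n"
proof -
  have U: "4 * s ^ 2 * ?U = real n + 2 - gegenbauer_fps 1 (cos \<theta>) $ Suc n"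
    using neg_rpow_2_mult_gegenbauer_nth[of "cos \<theta>" n] assms(2) by simp
  have abs: "\<bar>gegenbauer_fps 1 (cos \<theta>) $ Suc n\<bar> \<le> real n + 2"
    using abs_gegenbauer_le[of 1 \<theta> "Suc n"] by (simp add: neg_rpow_2_nth)
  have "0 \<le> x - g \<and> x - g \<le> 2 * x" if "\<bar>g\<bar> \<le> x" for x g :: real
    using that by linarith
  from this[OF abs] have U_bounds: "0 \<le> 4 * s ^ 2 * ?U" "4 * s ^ 2 * ?U \<le> 2 * (real n + 2)"
    by (simp_all only: U)
  have s2: "s ^ 2 > 0" using assms by simp
  show "0 \<le> ?U" using U_bounds(1) s2 by (simp add: zero_le_mult_iff)
  have B: "(neg_rpow 2 * (1 - fps_const (1/2) * fps_X)) $ n = (real n + 2) / 2"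
  proof -
    have "neg_rpow 2 * (1 - fps_const (1/2) * fps_X) = neg_rpow 2 - fps_const (1/2) * (fps_X * neg_rpow 2)"
      by (simp add: algebra_simps)
    then show ?thesis by (cases n) (simp_all add: neg_rpow_2_nth field_simps)
  qed
  show "?U \<le> (fps_const (1 / s ^ 2) * (neg_rpow 2 * (1 - fps_const (1/2) * fps_X))) $ n"
    using U_bounds(2) s2 by (simp only: fps_mult_left_const_nth B) (simp add: field_simps)
qed

lemma dimension_induction:
  assumes s: "s > 0" "1 - cos \<theta> = 2 * s ^ 2"
    and E: "\<And>n. E $ n \<le> (fps_const c * neg_rpow b) $ n" and "c \<ge> 0" "b \<ge> 0"
  shows "(E * (neg_rpow 2 * gegenbauer_fps 1 (cos \<theta>)) ^ m) $ n
    \<le> c / s ^ (2 * m) * (neg_rpow (b + 2 * real m) * (1 - fps_const (1/2) * fps_X) ^ m) $ n"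
proof -
  let ?H = "1 - fps_const (1/2) * fps_X :: real fps"
  let ?g = "fps_const (1 / s ^ 2) * (neg_rpow 2 * ?H)"
  have "(E * (neg_rpow 2 * gegenbauer_fps 1 (cos \<theta>)) ^ m) $ n \<le> (fps_const c * neg_rpow b * ?g ^ m) $ n"
    by (intro fps_mult_nth_mono E fps_power_nth_nonneg fps_power_nth_mono dimension_step_nth[OF s])
       (simp add: assms neg_rpow_nth_nonneg)
  also have "fps_const c * neg_rpow b * ?g ^ m = fps_const (c / s ^ (2 * m)) * (neg_rpow (b + 2 * real m) * ?H ^ m)"
  proof -
    have "fps_const (c / s ^ (2 * m)) = fps_const c * fps_const (1 / s ^ 2) ^ m"
      by (simp add: fps_const_power power_divide power_mult)
    then show ?thesis
      by (simp only: power_mult_distrib neg_rpow_power neg_rpow_add ac_simps)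
  qed
  finally show ?thesis by simp
qed

text \<open>The kernel is split as a base kernel times U^m with m the floor of \<lambda>. The base
  belongs to \<lambda> = 0 for odd d and to \<lambda> = 1/2 for even d, and contributes s^(-2) or
  s^(-3).\<close>

lemma kogbetliantz_fps_nth_le:
  fixes d :: nat
  assumes s: "s > 0" "1 - cos \<theta> = 2 * s ^ 2" and d: "d \<ge> 2" and lam: "lam = (real d - 1) / 2"
  shows "((1 + fps_X) * neg_rpow (2 * lam + 1) * gegenbauer_fps (lam + 1) (cos \<theta>)) $ n
    \<le> 1 / s powr (2 * lam + 2) *
       (neg_rpow (2 * lam + 1) * (1 - fps_const (1/2) * fps_X) ^ nat \<lfloor>lam\<rfloor>) $ n"
proof -
  let ?G = "\<lambda>a. gegenbauer_fps a (cos \<theta>)"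
  let ?\<Phi> = "(1 + fps_X) * neg_rpow 1 * ?G 1"
  have s2: "s ^ 2 > 0" using s by simp
  have le1: "cos \<theta> < 1" using s(2) s2 by linarith
  have \<Phi>_le: "?\<Phi> $ k \<le> (fps_const (1 / s ^ 2) * neg_rpow 1) $ k" for k
    using fejer_kernel_le[of "cos \<theta>" k] le1 s(2) by simp
  have U: "neg_rpow (a + 2 * real m) * ?G (b + real m) = neg_rpow a * ?G b * (neg_rpow 2 * ?G 1) ^ m" for a b m
    by (simp only: power_mult_distrib neg_rpow_power gegenbauer_fps_power neg_rpow_add gegenbauer_fps_add
        mult_1 ac_simps)
  define m where "m = (d - 1) div 2"
  consider "lam = real m" | "lam = real m + 1/2"
  proof -
    have "d = 2 * m + 1 \<or> d = 2 * m + 2" using d unfolding m_def by presburger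
    then show ?thesis using that lam by auto
  qed
  then show ?thesis
  proof cases
    case 1
    have F: "(1 + fps_X) * neg_rpow (2 * lam + 1) * ?G (lam + 1) = ?\<Phi> * (neg_rpow 2 * ?G 1) ^ m"
      using U[of 1 m 1] unfolding 1 by (simp only: ac_simps)
    have "(?\<Phi> * (neg_rpow 2 * ?G 1) ^ m) $ n \<le>
        (1 / s ^ 2) / s ^ (2 * m) * (neg_rpow (1 + 2 * real m) * (1 - fps_const (1/2) * fps_X) ^ m) $ n"
      by (rule dimension_induction[OF s \<Phi>_le]) simp_all
    moreover have "s powr (2 * lam + 2) = s ^ 2 * s ^ (2 * m)"
      using s(1) powr_realpow[of s "2 * m + 2"] unfolding 1 by (simp add: power_add power2_eq_square power3_eq_cube mult.commute add.commute)
    moreover have "nat \<lfloor>lam\<rfloor> = m" "1 + 2 * real m = 2 * lam + 1" unfolding 1 by simp_all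
    ultimately show ?thesis unfolding F by simp
  next
    case 2
    have m: "nat \<lfloor>lam\<rfloor> = m" unfolding 2 by linarith
    let ?E = "neg_rpow 1 * ?G (1/2) * ?\<Phi>"
    have E: "?E $ k \<le> (fps_const (1 / s ^ 3) * neg_rpow 2) $ k" for k
    proof -
      \<comment> \<open>The Legendre bound is used at q = (1 + cos \<theta>)/2 = cos^2(\<theta>/2),
        where 2q - 1 = cos \<theta> and sqrt(1 - q) = s.\<close>
      have "1 - (1 + cos \<theta>) / 2 = s ^ 2" using s(2) by (simp add: field_simps)
      then have "sqrt (1 - (1 + cos \<theta>) / 2) = s" using s(1) by simp
      moreover have "2 * ((1 + cos \<theta>) / 2) - 1 = cos \<theta>" by (simp add: field_simps)
      ultimately have half: "(neg_rpow 1 * ?G (1/2)) $ i \<le> (fps_const (1 / s) * neg_rpow 1) $ i" for i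
        using sum_legendre_le[of "(1 + cos \<theta>) / 2" i] cos_ge_minus_one[of \<theta>] le1
        by (simp only:) simp
      have "?E $ k \<le> ((fps_const (1 / s) * neg_rpow 1) * (fps_const (1 / s ^ 2) * neg_rpow 1)) $ k"
        by (rule fps_mult_nth_mono[OF fejer_kernel_nonneg[OF le1] \<Phi>_le half]) (use s(1) in simp)
      also have "(fps_const (1 / s) * neg_rpow 1) * (fps_const (1 / s ^ 2) * neg_rpow 1) =
          (fps_const (1 / s) * fps_const (1 / s ^ 2)) * (neg_rpow 1 * neg_rpow 1)"
        by (simp only: ac_simps)
      also have "\<dots> = fps_const (1 / s ^ 3) * neg_rpow 2"
        using neg_rpow_add[of 1 1] by (simp add: power2_eq_square power3_eq_cube)
      finally show ?thesis .
    qed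
    have F: "(1 + fps_X) * neg_rpow (2 * lam + 1) * ?G (lam + 1) = ?E * (neg_rpow 2 * ?G 1) ^ m"
    proof -
      have eqs: "2 * lam + 1 = (1 + 1) + 2 * real m" "lam + 1 = (1/2 + 1) + real m"
        unfolding 2 by simp_all
      show ?thesis
        unfolding eqs mult.assoc U neg_rpow_add[of 1 1] gegenbauer_fps_add[of "1/2" 1]
        by (simp only: ac_simps)
    qed
    have "(?E * (neg_rpow 2 * ?G 1) ^ m) $ n \<le>
        (1 / s ^ 3) / s ^ (2 * m) * (neg_rpow (2 + 2 * real m) * (1 - fps_const (1/2) * fps_X) ^ m) $ n"
      by (rule dimension_induction[OF s E]) (use s(1) in simp_all)
    moreover have "s powr (2 * lam + 2) = s ^ 3 * s ^ (2 * m)"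
      using s(1) powr_realpow[of s "2 * m + 3"] unfolding 2 by (simp add: power_add power2_eq_square power3_eq_cube mult.commute add.commute)
    moreover have "2 + 2 * real m = 2 * lam + 1" unfolding 2 by simp
    ultimately show ?thesis unfolding F by (simp add: m)
  qed
qed

section \<open>From series coefficients to falling factorials\<close>

text \<open>Lowering the exponent by one multiplies the coefficient by b/(b + n), since b (b+1)_n =
  (b)_n (b + n) for rising factorials. The product form postpones the division until positivity is
  known.\<close>

lemma neg_rpow_ffact:
  "neg_rpow (\<alpha> + 1 - real j) $ n * ffact (real n + \<alpha>) j = neg_rpow (\<alpha> + 1) $ n * ffact \<alpha> j"
proof (induction j)
  case (Suc j)
  define b where "b = \<alpha> - real j"
  have "pochhammer b n * (b + real n) = pochhammer (b + 1) n * b"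
    using pochhammer_rec[of b n] pochhammer_rec'[of b n] by (simp add: mult.commute)
  then have "neg_rpow b $ n * (b + real n) = neg_rpow (b + 1) $ n * b"
    by (simp add: neg_rpow_nth)
  moreover have "ffact x (Suc j) = (x - real j) * ffact x j" for x
    by (simp add: ffact_def)
  moreover have "\<alpha> + 1 - real (Suc j) = b" "real n + \<alpha> - real j = b + real n" "\<alpha> - real j = b"
      "\<alpha> + 1 - real j = b + 1"
    by (simp_all add: b_def)
  ultimately show ?case
    using Suc by (metis mult.assoc mult.commute)
qed (simp add: ffact_def)

text \<open>Writing 1 - X/2 as half of (1 - X) + 1 avoids alternating signs, and each factor 1 - X
  just lowers the exponent.\<close>

lemma neg_rpow_mult_half_power_nth:
  "(neg_rpow a * (1 - fps_const (1/2) * fps_X) ^ m) $ n =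
     1 / 2 ^ m * (\<Sum>l=0..m. real (m choose l) * neg_rpow (a - real l) $ n)"
proof -
  have "1 - fps_const (1/2) * fps_X = fps_const (1/2) * ((1 - fps_X) + 1 :: real fps)"
    by (rule fps_ext) (simp add: fps_X_def numeral_fps_const)
  then have "(1 - fps_const (1/2) * fps_X :: real fps) ^ m =
      fps_const ((1/2) ^ m) * (\<Sum>l\<le>m. of_nat (m choose l) * (1 - fps_X) ^ l)"
    by (simp only: power_mult_distrib fps_const_power binomial_ring[of "1 - fps_X"] power_one mult_1_right)
  then have "neg_rpow a * (1 - fps_const (1/2) * fps_X) ^ m =
      fps_const ((1/2) ^ m) * (\<Sum>l\<le>m. of_nat (m choose l) * ((1 - fps_X) ^ l * neg_rpow a))"
    by (simp only: sum_distrib_left ac_simps)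
  also have "\<dots> = fps_const (1 / 2 ^ m) * (\<Sum>l\<le>m. fps_const (real (m choose l)) * neg_rpow (a - real l))"
    by (simp add: neg_rpow_diff_of_nat power_one_over fps_of_nat)
  finally show ?thesis
    by (simp add: fps_sum_nth atLeast0AtMost)
qed

section \<open>The second estimate: the kernel at t = 1\<close>

lemma ffact_pochhammer: "ffact (real n + b) n = pochhammer (b + 1) n"
proof (induction n)
  case (Suc n)
  have "ffact (real (Suc n) + b) (Suc n) = (real (Suc n) + b) * ffact (real n + b) n"
    by (simp add: ffact_def prod.lessThan_Suc_shift algebra_simps del: prod.lessThan_Suc)
  with Suc show ?case by (simp add: pochhammer_Suc algebra_simps)
qed (simp add: ffact_def)

text \<open>Split 1 + X = (1 - X) + 2X; X (1 - X)^(-b-1) is X d/dX of (1 - X)^(-b), divided by b. It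
  serves with b = 2\<lambda> for the weighted Gegenbauer values at 1 and with b = 4\<lambda> + 2 for
  the kernel there.\<close>

lemma one_plus_X_neg_rpow_nth:
  assumes "b \<noteq> 0"
  shows "((1 + fps_X) * neg_rpow (b + 1)) $ n = neg_rpow b $ n * (1 + 2 * real n / b)"
proof -
  have "fps_X * neg_rpow (b + 1) = fps_const (1 / b) * (fps_X * fps_deriv (neg_rpow b))"
    using assms by (simp add: neg_rpow_deriv mult.left_commute flip: mult.assoc)
  moreover have "(1 + fps_X) * neg_rpow (b + 1) = (1 - fps_X) * neg_rpow (b + 1) + fps_const 2 * (fps_X * neg_rpow (b + 1))"
    by (simp add: algebra_simps numeral_fps_const)
  ultimately have "(1 + fps_X) * neg_rpow (b + 1) =
      neg_rpow b + fps_const 2 * (fps_const (1 / b) * (fps_X * fps_deriv (neg_rpow b)))"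
    by (simp only: neg_rpow_Suc)
  then show ?thesis
    by (cases n) (simp_all only: fps_add_nth fps_mult_left_const_nth, simp_all add: algebra_simps add_divide_distrib)
qed

text \<open>All weights are nonnegative, so each Gegenbauer polynomial may be replaced by its
  maximum, the coefficient of (1 - X)^(-2\<lambda>); the resulting convolution is then a product of
  known series.\<close>

lemma kogbetliantz_kernel_le_max:
  assumes "lam > 0"
  shows "cesaro_number (2 * lam + 1) n * kogbetliantz_kernel lam n (cos \<theta>) \<le>
    ((1 + fps_X) * neg_rpow (4 * lam + 3)) $ n"
proof -
  have "cesaro_number (2 * lam + 1) n * kogbetliantz_kernel lam n (cos \<theta>) =
      (\<Sum>k=0..n. cesaro_number (2 * lam + 1) (n - k) * ((real k + lam) / lam) * gegenbauer lam k (cos \<theta>))"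
    using cesaro_number_pos[of "2 * lam + 1" n] assms by (simp add: kogbetliantz_kernel_def)
  also have "\<dots> \<le> (\<Sum>k=0..n. cesaro_number (2 * lam + 1) (n - k) * ((real k + lam) / lam) * neg_rpow (2 * lam) $ k)"
    using assms abs_gegenbauer_le[of lam \<theta>]
    by (intro sum_mono mult_left_mono)
       (auto simp: gegenbauer_fps_nth abs_le_iff cesaro_number_pos less_imp_le)
  also have "\<dots> = (Abs_fps (\<lambda>k. (real k + lam) / lam * neg_rpow (2 * lam) $ k) * neg_rpow (2 * lam + 2)) $ n"
    unfolding fps_mult_nth cesaro_number_eq by (simp add: mult_ac add.assoc)
  also have "Abs_fps (\<lambda>k. (real k + lam) / lam * neg_rpow (2 * lam) $ k) = (1 + fps_X) * neg_rpow (2 * lam + 1)"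
  proof (rule fps_ext)
    have "(real k + lam) / lam * x = x * (1 + 2 * real k / (2 * lam))" for k x
      using assms by (simp add: field_simps)
    then show "Abs_fps (\<lambda>k. (real k + lam) / lam * neg_rpow (2 * lam) $ k) $ k =
        ((1 + fps_X) * neg_rpow (2 * lam + 1)) $ k" for k
      using assms by (simp only: one_plus_X_neg_rpow_nth[of "2 * lam"] fps_nth_Abs_fps)
  qed
  also have "(1 + fps_X) * neg_rpow (2 * lam + 1) * neg_rpow (2 * lam + 2) = (1 + fps_X) * neg_rpow (4 * lam + 3)"
    using neg_rpow_add[of "2 * lam + 1" "2 * lam + 2"] by (simp add: mult.assoc add.commute)
  finally show ?thesis .
qed

theorem theorem1:
  fixes d n :: nat and lam :: real
  assumes "d \<ge> 2" and "lam = (real d - 1) / 2"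
  shows "(\<forall>\<theta>. 0 < \<theta> \<and> \<theta> \<le> pi \<longrightarrow>
            kogbetliantz_kernel lam n (cos \<theta>) \<le>
              1 / (2 ^ nat \<lfloor>lam\<rfloor> * sin (\<theta> / 2) powr (2 * lam + 2)) *
              (\<Sum>l=0..nat \<lfloor>lam\<rfloor>. real (nat \<lfloor>lam\<rfloor> choose l) *
                 (ffact (2 * lam + 1) (l + 1) / ffact (real n + 2 * lam + 1) (l + 1))))
       \<and> (\<forall>\<theta>. 0 \<le> \<theta> \<and> \<theta> \<le> pi \<longrightarrow>
            kogbetliantz_kernel lam n (cos \<theta>) \<le>
              ffact (real n + 4 * lam + 1) n / ffact (real n + 2 * lam) n)"
proof (intro conjI allI impI)
  have lam: "lam > 0" using assms by simp
  define A where "A = cesaro_number (2 * lam + 1) n"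
  have A: "A > 0" unfolding A_def using lam by (intro cesaro_number_pos) simp
  {
    fix \<theta> :: real
    assume \<theta>: "0 < \<theta> \<and> \<theta> \<le> pi"
    define m where "m = nat \<lfloor>lam\<rfloor>"
    define s where "s = sin (\<theta> / 2)"
    have s: "s > 0" unfolding s_def using \<theta> by (intro sin_gt_zero) auto
    have "1 - cos \<theta> = 2 * s ^ 2"
      using cos_double_sin[of "\<theta> / 2"] by (simp add: s_def)
    from kogbetliantz_fps_nth_le[OF s this assms, of n]
    have "A * kogbetliantz_kernel lam n (cos \<theta>) \<le>
        1 / s powr (2 * lam + 2) * (1 / 2 ^ m * (\<Sum>l=0..m. real (m choose l) * neg_rpow (2 * lam + 1 - real l) $ n))"
      unfolding A_def kogbetliantz_kernel_eq_fps[OF lam] m_def neg_rpow_mult_half_power_nth .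
    also have "(\<Sum>l=0..m. real (m choose l) * neg_rpow (2 * lam + 1 - real l) $ n) =
        (\<Sum>l=0..m. real (m choose l) * (A * (ffact (2 * lam + 1) (l + 1) / ffact (real n + 2 * lam + 1) (l + 1))))"
    proof (intro sum.cong refl arg_cong2[of _ _ _ _ "(*)"])
      fix l assume "l \<in> {0..m}"
      \<comment> \<open>This makes every factor of the denominator positive, the smallest being n +
        2\<lambda> + 1 - l \<ge> \<lambda> + 1.\<close>
      then have "real l \<le> lam" unfolding m_def using lam by (simp add: le_nat_iff le_floor_iff)
      then have "ffact (real n + 2 * lam + 1) (l + 1) > 0"
        unfolding ffact_def using lam by (intro prod_pos) auto
      \<comment> \<open>The falling factorials have length l + 1 because A is a coefficient of (1 -
        X)^(-2\<lambda>-2), one exponent above the term l = 0.\<close>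
      then show "neg_rpow (2 * lam + 1 - real l) $ n =
          A * (ffact (2 * lam + 1) (l + 1) / ffact (real n + 2 * lam + 1) (l + 1))"
        using neg_rpow_ffact[of "2 * lam + 1" "l + 1" n]
        by (simp add: A_def cesaro_number_eq field_simps)
    qed
    also have "1 / s powr (2 * lam + 2) * (1 / 2 ^ m * \<dots>) = A * (1 / (2 ^ m * s powr (2 * lam + 2)) *
        (\<Sum>l=0..m. real (m choose l) * (ffact (2 * lam + 1) (l + 1) / ffact (real n + 2 * lam + 1) (l + 1))))"
      by (simp add: sum_distrib_left mult_ac)
    finally show "kogbetliantz_kernel lam n (cos \<theta>) \<le>
              1 / (2 ^ nat \<lfloor>lam\<rfloor> * sin (\<theta> / 2) powr (2 * lam + 2)) *
              (\<Sum>l=0..nat \<lfloor>lam\<rfloor>. real (nat \<lfloor>lam\<rfloor> choose l) *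
                 (ffact (2 * lam + 1) (l + 1) / ffact (real n + 2 * lam + 1) (l + 1)))"
      unfolding mult_le_cancel_left_pos[OF A] m_def s_def .
  next
    fix \<theta> :: real
    let ?b = "4 * lam + 2"
    have P: "pochhammer (2 * lam + 1) n > 0" using lam by (intro pochhammer_pos) simp
    have "A * kogbetliantz_kernel lam n (cos \<theta>) \<le> ((1 + fps_X) * neg_rpow (?b + 1)) $ n"
      using kogbetliantz_kernel_le_max[OF lam, of n \<theta>] by (simp add: A_def add.assoc)
    also have "\<dots> = neg_rpow ?b $ n * (1 + 2 * real n / ?b)"
      using lam by (intro one_plus_X_neg_rpow_nth) simp
    also have "1 + 2 * real n / ?b = (2 * lam + 1 + real n) / (2 * lam + 1)"
      using lam by (simp add: field_simps)
    \<comment> \<open>The linear factor is rewritten so that its numerator, over n!, is exactly A;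
      the denominator becomes the falling factorial of n + 2\<lambda>.\<close>
    also have "\<dots> = pochhammer (2 * lam + 2) n / pochhammer (2 * lam + 1) n"
      using pochhammer_rec[of "2 * lam + 1" n] pochhammer_rec'[of "2 * lam + 1" n] lam P
      by (simp add: field_simps)
    also have "neg_rpow ?b $ n * \<dots> = A * (ffact (real n + 4 * lam + 1) n / ffact (real n + 2 * lam) n)"
      using ffact_pochhammer[of n "4 * lam + 1"] ffact_pochhammer[of n "2 * lam"]
      by (simp add: A_def cesaro_number_eq neg_rpow_nth add.assoc)
    finally show "kogbetliantz_kernel lam n (cos \<theta>) \<le>
        ffact (real n + 4 * lam + 1) n / ffact (real n + 2 * lam) n"
      unfolding mult_le_cancel_left_pos[OF A] .
  }
qed

end
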